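(* Let $\varepsilon \in (0,1)$ and let $X = \{x_1, \ldots, x_n\} \subseteq \{0,1\}^d$, and let $A$ be the $n \times n$ matrix with $A_{i,j} = \|x_i - x_j\|_\infty$. Then there is an $n \times n$ matrix $B$ with $\|A - B\|_\infty \le \varepsilon$ such that for any query $y \in \mathbb{R}^n$ one can compute $By$ in time $O(n (2d)^{\sqrt{d} \log(1/\varepsilon)})$.
   Context: For matrices, $\|A - B\|_\infty = \max_{i,j} |A_{i,j} - B_{i,j}|$ (entrywise maximum). For vectors, $\|v\|_\infty = \max_i |v_i|$. *)

theory Defs
  imports Complex_Main "Jordan_Normal_Form.Matrix"
begin

section \<open>Maximum norms\<close>

text \<open>Both norms are only meaningful in positive dimension.\<close>

definition vec_max_norm :: "real vec \<Rightarrow> real" where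
  "vec_max_norm v = Max {\<bar>v $ i\<bar> | i. i < dim_vec v}"

definition mat_max_norm :: "real mat \<Rightarrow> real" where
  "mat_max_norm M = Max {\<bar>M $$ (i, j)\<bar> | i j. i < dim_row M \<and> j < dim_col M}"

definition hypercube :: "nat \<Rightarrow> real vec set" where
  "hypercube d = {v \<in> carrier_vec d. \<forall>k<d. v $ k \<in> {0, 1}}"

definition linf_dist_mat :: "nat \<Rightarrow> (nat \<Rightarrow> real vec) \<Rightarrow> real mat" where
  "linf_dist_mat n x = mat n n (\<lambda>(i, j). vec_max_norm (x i - x j))"


section \<open>A real random access machine\<close>

text \<open>
  Running time is measured on a unit-cost real RAM, presented as a structured imperative
  language.  Memory consists of named, unbounded arrays, of natural numbers (used for counters
  and addresses) and of real numbers; a scalar is cell 0 of an array.  A program mentions only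
  finitely many names, so this is a RAM memory up to interleaving.

  Every operation (memory access, arithmetic operation, comparison, control step) costs one unit.
  Unit-cost multiplication on unbounded addresses or a floor function on reals would make the
  machine unreasonably powerful, so, as for the RAM of Cook and Reckhow, natural numbers can only
  be added and subtracted, and reals are only combined by field operations and compared.
  For the same reason real constants in programs are integers.
\<close>

type_synonym name = string

datatype nexp =
    NConst nat
  | NRead name nexp
  | NAdd nexp nexp
  | NSub nexp nexp

datatype rexp =
    RConst int
  | RRead name nexp
  | RAdd rexp rexp
  | RSub rexp rexp
  | RMul rexp rexp
  | RDiv rexp rexp

datatype bexp =
    NLess nexp nexp
  | RLess rexp rexp
  | BNot bexp
  | BAnd bexp bexp

datatype com =
    Skip
  | NWrite name nexp nexp  \<comment> \<open>array, address, value\<close>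
  | RWrite name nexp rexp
  | Seq com com
  | Cond bexp com com
  | While bexp com

record state =
  nats :: "name \<Rightarrow> nat \<Rightarrow> nat"
  reals :: "name \<Rightarrow> nat \<Rightarrow> real"

fun nval :: "nexp \<Rightarrow> state \<Rightarrow> nat" where
  "nval (NConst c) s = c"
| "nval (NRead a e) s = nats s a (nval e s)"
| "nval (NAdd e f) s = nval e s + nval f s"
| "nval (NSub e f) s = nval e s - nval f s"

fun rval :: "rexp \<Rightarrow> state \<Rightarrow> real" where
  "rval (RConst c) s = of_int c"
| "rval (RRead a e) s = reals s a (nval e s)"
| "rval (RAdd e f) s = rval e s + rval f s"
| "rval (RSub e f) s = rval e s - rval f s"
| "rval (RMul e f) s = rval e s * rval f s"
| "rval (RDiv e f) s = rval e s / rval f s"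

fun bval :: "bexp \<Rightarrow> state \<Rightarrow> bool" where
  "bval (NLess e f) s \<longleftrightarrow> nval e s < nval f s"
| "bval (RLess e f) s \<longleftrightarrow> rval e s < rval f s"
| "bval (BNot b) s \<longleftrightarrow> \<not> bval b s"
| "bval (BAnd b c) s \<longleftrightarrow> bval b s \<and> bval c s"

fun ncost :: "nexp \<Rightarrow> nat" where
  "ncost (NConst c) = 1"
| "ncost (NRead a e) = 1 + ncost e"
| "ncost (NAdd e f) = 1 + ncost e + ncost f"
| "ncost (NSub e f) = 1 + ncost e + ncost f"

fun rcost :: "rexp \<Rightarrow> nat" where
  "rcost (RConst c) = 1"
| "rcost (RRead a e) = 1 + ncost e"
| "rcost (RAdd e f) = 1 + rcost e + rcost f"
| "rcost (RSub e f) = 1 + rcost e + rcost f"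
| "rcost (RMul e f) = 1 + rcost e + rcost f"
| "rcost (RDiv e f) = 1 + rcost e + rcost f"

fun bcost :: "bexp \<Rightarrow> nat" where
  "bcost (NLess e f) = 1 + ncost e + ncost f"
| "bcost (RLess e f) = 1 + rcost e + rcost f"
| "bcost (BNot b) = 1 + bcost b"
| "bcost (BAnd b c) = 1 + bcost b + bcost c"

definition store :: "(name \<Rightarrow> nat \<Rightarrow> 'a) \<Rightarrow> name \<Rightarrow> nat \<Rightarrow> 'a \<Rightarrow> name \<Rightarrow> nat \<Rightarrow> 'a" where
  "store m a k v = m(a := (m a)(k := v))"

text \<open>\<open>runs c s t s'\<close>: started in \<open>s\<close>, command \<open>c\<close> halts in \<open>s'\<close> after \<open>t\<close> units of time.\<close>

inductive runs :: "com \<Rightarrow> state \<Rightarrow> nat \<Rightarrow> state \<Rightarrow> bool" where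
  Skip: "runs Skip s 1 s"
| NWrite: "runs (NWrite a e f) s (1 + ncost e + ncost f)
    (s\<lparr>nats := store (nats s) a (nval e s) (nval f s)\<rparr>)"
| RWrite: "runs (RWrite a e f) s (1 + ncost e + rcost f)
    (s\<lparr>reals := store (reals s) a (nval e s) (rval f s)\<rparr>)"
| Seq: "runs c1 s1 t1 s2 \<Longrightarrow> runs c2 s2 t2 s3 \<Longrightarrow> runs (Seq c1 c2) s1 (t1 + t2) s3"
| CondTrue: "bval b s \<Longrightarrow> runs c1 s t s' \<Longrightarrow> runs (Cond b c1 c2) s (1 + bcost b + t) s'"
| CondFalse: "\<not> bval b s \<Longrightarrow> runs c2 s t s' \<Longrightarrow> runs (Cond b c1 c2) s (1 + bcost b + t) s'"
| WhileFalse: "\<not> bval b s \<Longrightarrow> runs (While b c) s (1 + bcost b) s"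
| WhileTrue: "bval b s1 \<Longrightarrow> runs c s1 t1 s2 \<Longrightarrow> runs (While b c) s2 t2 s3
    \<Longrightarrow> runs (While b c) s1 (1 + bcost b + t1 + t2) s3"

inductive_cases runs_SkipE: "runs Skip s t s'"
inductive_cases runs_NWriteE: "runs (NWrite a e f) s t s'"
inductive_cases runs_RWriteE: "runs (RWrite a e f) s t s'"
inductive_cases runs_SeqE: "runs (Seq c1 c2) s t s'"
inductive_cases runs_CondE: "runs (Cond b c1 c2) s t s'"
inductive_cases runs_WhileE: "runs (While b c) s t s'"

lemma runs_deterministic:
  "runs c s t s' \<Longrightarrow> runs c s u s'' \<Longrightarrow> u = t \<and> s'' = s'"
proof (induction arbitrary: u s'' rule: runs.induct)
  case (Skip s)
  then show ?case by (auto elim: runs_SkipE)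
next
  case (NWrite a e f s)
  then show ?case by (auto elim: runs_NWriteE)
next
  case (RWrite a e f s)
  then show ?case by (auto elim: runs_RWriteE)
next
  case (Seq c1 s1 t1 s2 c2 t2 s3)
  from Seq.prems obtain v1 v2 r where
    "u = v1 + v2" "runs c1 s1 v1 r" "runs c2 r v2 s''" by (rule runs_SeqE)
  with Seq.IH(1)[of v1 r] Seq.IH(2)[of v2 s''] show ?case by simp
next
  case (CondTrue b s c1 t s' c2)
  from CondTrue.prems CondTrue.hyps obtain v where
    "u = 1 + bcost b + v" "runs c1 s v s''" by (auto elim: runs_CondE)
  with CondTrue.IH[of v s''] show ?case by simp
next
  case (CondFalse b s c2 t s' c1)
  from CondFalse.prems CondFalse.hyps obtain v where
    "u = 1 + bcost b + v" "runs c2 s v s''" by (auto elim: runs_CondE)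
  with CondFalse.IH[of v s''] show ?case by simp
next
  case (WhileFalse b s c)
  from WhileFalse.prems show ?case
    by (rule runs_WhileE) (use WhileFalse.hyps in simp_all)
next
  case (WhileTrue b s1 c t1 s2 t2 s3)
  from WhileTrue.prems obtain v1 v2 r where
    "u = 1 + bcost b + v1 + v2" "runs c s1 v1 r" "runs (While b c) r v2 s''"
    by (rule runs_WhileE) (use WhileTrue.hyps in simp_all)
  with WhileTrue.IH(1)[of v1 r] WhileTrue.IH(2)[of v2 s''] show ?case by simp
qed


section \<open>Matrix-vector queries\<close>

text \<open>
  The input of a query: the numbers \<open>n\<close>, \<open>d\<close> and \<open>\<epsilon>\<close>, the points in row-major order, and the
  query vector.  All other memory is zero.  In particular the matrix is not part of the input.
\<close>

definition query_input :: "nat \<Rightarrow> nat \<Rightarrow> real \<Rightarrow> (nat \<Rightarrow> real vec) \<Rightarrow> real vec \<Rightarrow> state" where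
  "query_input n d \<epsilon> x y =
    \<lparr>nats = (\<lambda>a k. if a = ''n'' \<and> k = 0 then n else if a = ''d'' \<and> k = 0 then d else 0),
     reals = (\<lambda>a k. if a = ''eps'' \<and> k = 0 then \<epsilon>
                    else if a = ''x'' \<and> k < n * d then x (k div d) $ (k mod d)
                    else if a = ''y'' \<and> k < n then y $ k
                    else 0)\<rparr>"

definition computes_within :: "com \<Rightarrow> state \<Rightarrow> real vec \<Rightarrow> real \<Rightarrow> bool" where
  "computes_within P s v T \<longleftrightarrow>
    (\<exists>t s'. runs P s t s' \<and> real t \<le> T \<and> (\<forall>i<dim_vec v. reals s' ''out'' i = v $ i))"

end

(* The entry A i j is 0 if x i = x j and 1 otherwise.  If eps >= 1/2, the constant matrix 1/2 is
   close enough, and its product with y is read off the sum of y in time O(n).  If eps < 1/2, then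
   A itself is used: reading a point as a binary number gives an address that identifies it, the
   entries of y are added up per address, and (A y) i is the sum of y minus the total at the
   address of x i.  This takes time O(n d), and d is at most 4 (2d)^(sqrt d ln (1/eps)), because
   the exponent exceeds 1 as soon as d >= 4. *)

theory Submission
  imports Defs
begin

section \<open>Weakest preconditions with a time budget\<close>

text \<open>The postcondition receives the remaining budget.\<close>

definition wp :: "com \<Rightarrow> (nat \<Rightarrow> state \<Rightarrow> bool) \<Rightarrow> nat \<Rightarrow> state \<Rightarrow> bool" where
  "wp c Q T s \<longleftrightarrow> (\<exists>t s'. runs c s t s' \<and> t \<le> T \<and> Q (T - t) s')"

text \<open>By determinism the run hidden in \<open>wp\<close> can only be the given one, so for
  commands with a known run the existential becomes a computation.\<close>

lemma wp_runs: "runs c s t s' \<Longrightarrow> wp c Q T s \<longleftrightarrow> t \<le> T \<and> Q (T - t) s'"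
  unfolding wp_def by (metis runs_deterministic)

lemma wp_NWrite [simp]:
  "wp (NWrite a e f) Q T s \<longleftrightarrow> 1 + ncost e + ncost f \<le> T \<and>
    Q (T - (1 + ncost e + ncost f)) (s\<lparr>nats := store (nats s) a (nval e s) (nval f s)\<rparr>)"
  by (rule wp_runs[OF runs.NWrite])

lemma wp_RWrite [simp]:
  "wp (RWrite a e f) Q T s \<longleftrightarrow> 1 + ncost e + rcost f \<le> T \<and>
    Q (T - (1 + ncost e + rcost f)) (s\<lparr>reals := store (reals s) a (nval e s) (rval f s)\<rparr>)"
  by (rule wp_runs[OF runs.RWrite])

text \<open>Because postconditions receive the remaining budget, \<open>wp c2 Q\<close> is itself a
  postcondition for \<open>c1\<close>, and no division of \<open>T\<close> between the two commands
  has to be guessed.\<close>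

lemma wp_Seq [simp]: "wp (Seq c1 c2) Q T s \<longleftrightarrow> wp c1 (wp c2 Q) T s"
proof
  assume "wp (Seq c1 c2) Q T s"
  then obtain t1 t2 r s' where "runs c1 s t1 r" "runs c2 r t2 s'" "t1 + t2 \<le> T" "Q (T - (t1 + t2)) s'"
    unfolding wp_def by (blast elim: runs_SeqE)
  then show "wp c1 (wp c2 Q) T s"
    unfolding wp_def by (intro exI[of _ t1] exI[of _ r] exI[of _ t2] exI[of _ s'] conjI) auto
next
  assume "wp c1 (wp c2 Q) T s"
  then obtain t1 t2 r s' where
    *: "runs c1 s t1 r" "runs c2 r t2 s'" "t1 \<le> T" "t2 \<le> T - t1" "Q (T - t1 - t2) s'"
    unfolding wp_def by blast
  then show "wp (Seq c1 c2) Q T s"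
    unfolding wp_def
    by (intro exI[of _ "t1 + t2"] exI[of _ s'] conjI) (auto intro: runs.Seq)
qed

lemma wp_Cond [simp]:
  "wp (Cond b c1 c2) Q T s \<longleftrightarrow>
    1 + bcost b \<le> T \<and> wp (if bval b s then c1 else c2) Q (T - (1 + bcost b)) s"
proof
  assume "wp (Cond b c1 c2) Q T s"
  then obtain t s' where r: "runs (Cond b c1 c2) s t s'" "t \<le> T" "Q (T - t) s'"
    unfolding wp_def by blast
  then obtain u where
    "runs (if bval b s then c1 else c2) s u s'" "t = 1 + bcost b + u"
    by (auto elim: runs_CondE)
  with r show "1 + bcost b \<le> T \<and> wp (if bval b s then c1 else c2) Q (T - (1 + bcost b)) s"
    unfolding wp_def by (auto intro!: exI[of _ u] exI[of _ s'])
next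
  assume *: "1 + bcost b \<le> T \<and> wp (if bval b s then c1 else c2) Q (T - (1 + bcost b)) s"
  then obtain u s' where r: "runs (if bval b s then c1 else c2) s u s'"
    "u \<le> T - (1 + bcost b)" "Q (T - (1 + bcost b) - u) s'"
    unfolding wp_def by blast
  then have "runs (Cond b c1 c2) s (1 + bcost b + u) s'"
    by (cases "bval b s") (auto intro: runs.CondTrue[simplified] runs.CondFalse[simplified])
  with * r show "wp (Cond b c1 c2) Q T s"
    unfolding wp_def by (intro exI[of _ "1 + bcost b + u"] exI[of _ s']) (auto simp: algebra_simps)
qed

lemma wp_mono:
  assumes "wp c Q T s" and "T \<le> T'" and "\<And>t s'. Q t s' \<Longrightarrow> Q' (t + (T' - T)) s'"
  shows "wp c Q' T' s"
proof -
  from assms(1) obtain t s' where r: "runs c s t s'" "t \<le> T" "Q (T - t) s'"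
    unfolding wp_def by blast
  from r(2) assms(2) have "(T - t) + (T' - T) = T' - t" by simp
  with assms(3)[OF r(3)] r(1,2) assms(2) show ?thesis
    unfolding wp_def by (intro exI[of _ t] exI[of _ s']) auto
qed

text \<open>Splices a loop with a budget-independent postcondition \<open>Q\<close> into a larger
  program: \<open>T\<close> pays for the loop, \<open>T'\<close> for the rest. The loop may stop
  early and leave more than \<open>T'\<close>, hence the monotonicity premise on
  \<open>Q'\<close>.\<close>

lemma wp_conseq:
  assumes "wp c (\<lambda>_. Q) T s" and "\<And>s'. Q s' \<Longrightarrow> Q' T' s'"
    and "\<And>t t' s'. t \<le> t' \<Longrightarrow> Q' t s' \<Longrightarrow> Q' t' s'"
  shows "wp c Q' (T + T') s"
  by (rule wp_mono[OF assms(1)]) (auto intro: assms(3)[OF _ assms(2)])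

text \<open>Supplies the monotonicity premise of \<open>wp_conseq\<close> when the rest of the
  program is itself expressed by \<open>wp\<close>.\<close>

lemma wp_antimono_budget:
  assumes "\<And>t t' s'. t \<le> t' \<Longrightarrow> Q t s' \<Longrightarrow> Q t' s'"
  shows "t \<le> t' \<Longrightarrow> wp c Q t s \<Longrightarrow> wp c Q t' s"
  unfolding wp_def by (metis assms diff_le_mono order_trans)

text \<open>The number \<open>N\<close> of rounds is known in advance. Each round pays for the body
  and one guard test; the final failing test accounts for the summand outside the product.\<close>

lemma wp_While:
  assumes guard: "\<And>k s. k \<le> N \<Longrightarrow> I k s \<Longrightarrow> bval b s \<longleftrightarrow> k < N"
    and body: "\<And>k s. k < N \<Longrightarrow> I k s \<Longrightarrow> wp c (\<lambda>_. I (Suc k)) T s"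
    and "I 0 s"
    and budget: "N * (T + 1 + bcost b) + 1 + bcost b \<le> T'"
  shows "wp (While b c) (\<lambda>_. I N) T' s"
proof -
  \<comment> \<open>Generalised to a start in round \<open>k\<close>, so that induction on the
    remaining rounds \<open>N - k\<close> can peel off the first iteration.\<close>
  have "I k s \<Longrightarrow> k \<le> N \<Longrightarrow> \<exists>t s'. runs (While b c) s t s' \<and>
      t \<le> (N - k) * (T + 1 + bcost b) + 1 + bcost b \<and> I N s'" for k s
  proof (induction "N - k" arbitrary: k s)
    case 0
    then have "\<not> bval b s" "k = N" using guard[of k s] by auto
    then show ?case using runs.WhileFalse 0 by fastforce
  next
    case (Suc m)
    then have "k < N" "bval b s" "m = N - Suc k" using guard[of k s] by auto
    with Suc.prems body[of k s] obtain t1 r where r: "runs c s t1 r" "t1 \<le> T" "I (Suc k) r"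
      unfolding wp_def by blast
    with Suc.hyps(1)[of "Suc k" r] \<open>m = N - Suc k\<close> \<open>k < N\<close> obtain t2 s' where
      s': "runs (While b c) r t2 s'" "t2 \<le> m * (T + 1 + bcost b) + 1 + bcost b" "I N s'"
      by auto
    have "1 + bcost b + t1 + t2 \<le> (N - k) * (T + 1 + bcost b) + 1 + bcost b"
      using r(2) s'(2) by (simp flip: Suc.hyps(2))
    with s' runs.WhileTrue[OF \<open>bval b s\<close> r(1) s'(1)] show ?case by blast
  qed
  from this[OF \<open>I 0 s\<close>] obtain t s' where
    "runs (While b c) s t s'" "t \<le> N * (T + 1 + bcost b) + 1 + bcost b" "I N s'"
    by auto
  with budget show ?thesis
    unfolding wp_def by (intro exI[of _ t] exI[of _ s'] conjI) auto
qed


section \<open>Binary codes of points\<close>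

text \<open>Horner's scheme with coordinate 0 as the most significant bit. Doubling is written as an
  addition since the machine does not multiply natural numbers, and a bit is read by a comparison of
  reals.\<close>

fun code :: "nat \<Rightarrow> real vec \<Rightarrow> nat" where
  "code 0 v = 0"
| "code (Suc k) v = code k v + code k v + (if 0 < v $ k then 1 else 0)"

lemma code_eq_iff: "code k u = code k v \<longleftrightarrow> (\<forall>l<k. 0 < u $ l \<longleftrightarrow> 0 < v $ l)"
proof (induction k)
  case (Suc k)
  \<comment> \<open>The parity of the code reveals its last bit, and halving reveals the code of the
    prefix.\<close>
  have "a + a + (if p then 1 else 0) = b + b + (if q then 1 else 0) \<longleftrightarrow> a = b \<and> (p \<longleftrightarrow> q)"
    for a b :: nat and p q
    by (auto; presburger)
  with Suc show ?case by (auto simp: less_Suc_eq)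
qed simp

lemma code_eq_hypercube:
  assumes "u \<in> hypercube d" "v \<in> hypercube d"
  shows "code d u = code d v \<longleftrightarrow> u = v"
proof
  assume "code d u = code d v"
  then have "u $ l = v $ l" if "l < d" for l
    using assms that unfolding code_eq_iff hypercube_def by fastforce
  then show "u = v" using assms unfolding hypercube_def by (intro eq_vecI) auto
qed simp


section \<open>The distance matrix\<close>

lemma vec_max_norm_hypercube:
  assumes "u \<in> hypercube d" "v \<in> hypercube d" "1 \<le> d"
  shows "vec_max_norm (u - v) = (if u = v then 0 else 1)"
proof -
  have c: "u \<in> carrier_vec d" "v \<in> carrier_vec d" using assms unfolding hypercube_def by auto
  have b: "\<bar>(u - v) $ k\<bar> = (if u $ k = v $ k then 0 else 1)" if "k < d" for k
    using assms that unfolding hypercube_def by fastforce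
  have fin: "finite {\<bar>(u - v) $ k\<bar> | k. k < dim_vec (u - v)}" by simp
  show ?thesis unfolding vec_max_norm_def
  proof (rule Max_eqI[OF fin])
    fix r assume "r \<in> {\<bar>(u - v) $ k\<bar> | k. k < dim_vec (u - v)}"
    then obtain k where "r = \<bar>(u - v) $ k\<bar>" "k < d" using c by auto
    then show "r \<le> (if u = v then 0 else 1)" using b[of k] by simp
  next
    \<comment> \<open>A coordinate that attains the maximum: any one if the points agree, where
      \<open>1 \<le> d\<close> provides coordinate 0, and one where they differ otherwise.\<close>
    obtain k where "k < d" "u = v \<longleftrightarrow> u $ k = v $ k"
    proof (cases "u = v")
      case True
      with assms(3) show ?thesis by (intro that[of 0]) auto
    next
      case False
      with c show ?thesis by (metis carrier_vecD eq_vecI that)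
    qed
    then show "(if u = v then 0 else 1) \<in> {\<bar>(u - v) $ k\<bar> | k. k < dim_vec (u - v)}"
      using b[of k] c by (intro CollectI exI[of _ k]) simp
  qed
qed

lemma mat_max_norm_le:
  assumes "M \<in> carrier_mat n m" "1 \<le> n" "1 \<le> m"
    and "\<And>i j. i < n \<Longrightarrow> j < m \<Longrightarrow> \<bar>M $$ (i, j)\<bar> \<le> e"
  shows "mat_max_norm M \<le> e"
proof -
  have *: "{\<bar>M $$ (i, j)\<bar> | i j. i < dim_row M \<and> j < dim_col M} =
      (\<lambda>(i, j). \<bar>M $$ (i, j)\<bar>) ` ({..<n} \<times> {..<m})"
    using assms(1) by auto
  have "(\<lambda>(i, j). \<bar>M $$ (i, j)\<bar>) ` ({..<n} \<times> {..<m}) \<noteq> {}"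
    using assms(2,3) by (auto simp: lessThan_empty_iff)
  then show ?thesis unfolding mat_max_norm_def * using assms(4) by (subst Max_le_iff) auto
qed


section \<open>The query algorithm\<close>

abbreviation nvar :: "name \<Rightarrow> nexp" where "nvar a \<equiv> NRead a (NConst 0)"
abbreviation rvar :: "name \<Rightarrow> rexp" where "rvar a \<equiv> RRead a (NConst 0)"
abbreviation nset :: "name \<Rightarrow> nexp \<Rightarrow> com" where "nset a \<equiv> NWrite a (NConst 0)"
abbreviation nincr :: "name \<Rightarrow> com" where "nincr a \<equiv> nset a (NAdd (nvar a) (NConst 1))"

definition sum_body :: com where
  "sum_body = Seq
    (RWrite ''S'' (NConst 0) (RAdd (rvar ''S'') (RRead ''y'' (nvar ''i''))))
    (nincr ''i'')"

text \<open>The address \<open>i * d + k\<close> cannot be formed by a multiplication. Instead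
  \<open>p\<close> advances by one per coordinate and is never reset, so it walks through the
  row-major array \<open>x\<close>.\<close>

definition code_body :: com where
  "code_body = Seq
    (Cond (RLess (RConst 0) (RRead ''x'' (nvar ''p'')))
      (nset ''m'' (NAdd (NAdd (nvar ''m'') (nvar ''m'')) (NConst 1)))
      (nset ''m'' (NAdd (nvar ''m'') (nvar ''m''))))
    (Seq (nincr ''p'') (nincr ''k''))"

definition key_body :: com where
  "key_body = Seq (nset ''m'' (NConst 0)) (Seq (nset ''k'' (NConst 0))
    (Seq (While (NLess (nvar ''k'') (nvar ''d'')) code_body)
    (Seq (NWrite ''key'' (nvar ''i'') (nvar ''m''))
    (Seq (RWrite ''W'' (nvar ''m'') (RAdd (RRead ''W'' (nvar ''m'')) (RRead ''y'' (nvar ''i''))))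
      (nincr ''i'')))))"

definition out_body :: "rexp \<Rightarrow> com" where
  "out_body e = Seq (RWrite ''out'' (nvar ''i'') e) (nincr ''i'')"

definition for_points :: "com \<Rightarrow> com" where
  "for_points c = Seq (nset ''i'' (NConst 0)) (While (NLess (nvar ''i'') (nvar ''n'')) c)"

text \<open>This needs the completed totals in \<open>W\<close>, so it is evaluated in a separate
  pass; the stored \<open>key\<close> avoids reading the coordinates again.\<close>

definition exact_answer :: rexp where
  "exact_answer = RSub (rvar ''S'') (RRead ''W'' (NRead ''key'' (nvar ''i'')))"

definition half_answer :: rexp where
  "half_answer = RDiv (rvar ''S'') (RConst 2)"

text \<open>Real constants are integers, so \<open>eps\<close> is compared with 1/2 in the form
  \<open>2 * eps < 1\<close>.\<close>

definition query_prog :: com where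
  "query_prog = Seq (for_points sum_body)
    (Cond (RLess (RMul (RConst 2) (rvar ''eps'')) (RConst 1))
      (Seq (for_points key_body) (for_points (out_body exact_answer)))
      (for_points (out_body half_answer)))"

text \<open>The 6 is the cost of one guard test; the 9 consists of 3 for initialising
  \<open>i\<close> and 6 for the last test.\<close>

lemma wp_for_points:
  assumes "\<And>k s. k \<le> n \<Longrightarrow> I k s \<Longrightarrow> nats s ''n'' 0 = n \<and> nats s ''i'' 0 = k"
    and "\<And>k s. k < n \<Longrightarrow> I k s \<Longrightarrow> wp c (\<lambda>_. I (Suc k)) T s"
    and "I 0 (s\<lparr>nats := store (nats s) ''i'' 0 0\<rparr>)"
  shows "wp (for_points c) (\<lambda>_. I n) (n * (T + 6) + 9) s"
proof -
  have "wp (While (NLess (nvar ''i'') (nvar ''n'')) c) (\<lambda>_. I n)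
      (n * (T + 6) + 6)
      (s\<lparr>nats := store (nats s) ''i'' 0 0\<rparr>)"
    by (rule wp_While) (use assms in \<open>auto simp: algebra_simps\<close>)
  then show ?thesis unfolding for_points_def by (simp add: add.commute)
qed

section \<open>Loop invariants and running times\<close>

locale query =
  fixes n d :: nat and eps :: real and x :: "nat \<Rightarrow> real vec" and y :: "real vec"
begin

definition input :: "state \<Rightarrow> bool" where
  "input s \<longleftrightarrow> nats s ''n'' 0 = n \<and> nats s ''d'' 0 = d \<and> reals s ''eps'' 0 = eps \<and>
    (\<forall>i<n. \<forall>k<d. reals s ''x'' (i * d + k) = x i $ k) \<and> (\<forall>i<n. reals s ''y'' i = y $ i)"

text \<open>The zeros in \<open>p\<close> and \<open>W\<close> are recorded because the key loop
  starts from them without initialising either.\<close>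

definition sum_inv :: "nat \<Rightarrow> state \<Rightarrow> bool" where
  "sum_inv i s \<longleftrightarrow> input s \<and> nats s ''i'' 0 = i \<and> nats s ''p'' 0 = 0 \<and>
    reals s ''W'' = (\<lambda>_. 0) \<and> reals s ''S'' 0 = (\<Sum>j<i. y $ j)"

definition key_inv :: "nat \<Rightarrow> state \<Rightarrow> bool" where
  "key_inv i s \<longleftrightarrow> input s \<and> nats s ''i'' 0 = i \<and> nats s ''p'' 0 = i * d \<and>
    reals s ''S'' 0 = (\<Sum>j<n. y $ j) \<and> (\<forall>j<i. nats s ''key'' j = code d (x j)) \<and>
    (\<forall>m. reals s ''W'' m = (\<Sum>j<i. if code d (x j) = m then y $ j else 0))"

text \<open>The inner loop changes only \<open>p\<close>, \<open>k\<close> and \<open>m\<close>; the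
  facts on \<open>S\<close>, \<open>key\<close> and \<open>W\<close> are those of
  \<open>key_inv\<close>, carried along unchanged.\<close>

definition code_inv :: "nat \<Rightarrow> nat \<Rightarrow> state \<Rightarrow> bool" where
  "code_inv i k s \<longleftrightarrow> input s \<and> nats s ''i'' 0 = i \<and> nats s ''p'' 0 = i * d + k \<and>
    nats s ''k'' 0 = k \<and> nats s ''m'' 0 = code k (x i) \<and>
    reals s ''S'' 0 = (\<Sum>j<n. y $ j) \<and> (\<forall>j<i. nats s ''key'' j = code d (x j)) \<and>
    (\<forall>m. reals s ''W'' m = (\<Sum>j<i. if code d (x j) = m then y $ j else 0))"

text \<open>Refers to the state \<open>s0\<close> before the loop, so that one invariant serves both
  answer expressions.\<close>

definition out_inv :: "state \<Rightarrow> rexp \<Rightarrow> nat \<Rightarrow> state \<Rightarrow> bool" where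
  "out_inv s0 e i s \<longleftrightarrow> nats s = store (nats s0) ''i'' 0 i \<and>
    (\<forall>a. a \<noteq> ''out'' \<longrightarrow> reals s a = reals s0 a) \<and>
    (\<forall>j<i. reals s ''out'' j = rval e (s0\<lparr>nats := store (nats s0) ''i'' 0 j\<rparr>))"

lemma wp_sum:
  assumes "input s" "nats s ''p'' 0 = 0" "reals s ''W'' = (\<lambda>_. 0)" "reals s ''S'' 0 = 0"
  shows "wp (for_points sum_body) (\<lambda>_. sum_inv n) (n * 24 + 9) s"
proof -
  have "wp (for_points sum_body) (\<lambda>_. sum_inv n) (n * (18 + 6) + 9) s"
    by (rule wp_for_points)
      (use assms in \<open>auto simp: sum_inv_def input_def sum_body_def store_def\<close>)
  then show ?thesis by simp
qed

lemma wp_code: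
  assumes "code_inv i 0 s" "i < n"
  shows "wp (While (NLess (nvar ''k'') (nvar ''d'')) code_body) (\<lambda>_. code_inv i d) (d * 40 + 6) s"
proof -
  have "wp code_body (\<lambda>_. code_inv i (Suc k)) 34 s" if "k < d" "code_inv i k s" for k s
    using that \<open>i < n\<close> by (auto simp: code_inv_def input_def code_body_def store_def)
  then show ?thesis
    by (rule wp_While[rotated]) (use assms in \<open>auto simp: code_inv_def input_def\<close>)
qed

lemma wp_key:
  assumes "sum_inv n s"
  shows "wp (for_points key_body) (\<lambda>_. key_inv n) (n * (d * 40 + 60) + 9) s"
proof -
  have "wp key_body (\<lambda>_. key_inv (Suc i)) (d * 40 + 54) s" if "i < n" "key_inv i s" for i s
  proof -
    let ?s = "s\<lparr>nats := store (store (nats s) ''m'' 0 0) ''k'' 0 0\<rparr>"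
    let ?post = "wp (Seq (NWrite ''key'' (nvar ''i'') (nvar ''m''))
      (Seq (RWrite ''W'' (nvar ''m'') (RAdd (RRead ''W'' (nvar ''m'')) (RRead ''y'' (nvar ''i''))))
      (nincr ''i''))) (\<lambda>_. key_inv (Suc i))"
    have "code_inv i 0 ?s"
      using that by (auto simp: key_inv_def code_inv_def input_def store_def)
    from wp_code[OF this \<open>i < n\<close>]
    \<comment> \<open>The 42 units beyond the cost of the inner loop cover the three assignments
      that follow it.\<close>
    have "wp (While (NLess (nvar ''k'') (nvar ''d'')) code_body) ?post (d * 40 + 6 + 42) ?s"
    proof (rule wp_conseq)
      show "?post 42 s'" if "code_inv i d s'" for s'
        using that \<open>i < n\<close>
        by (auto simp: key_inv_def code_inv_def input_def store_def less_Suc_eq)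
    qed (rule wp_antimono_budget)
    then show ?thesis unfolding key_body_def by (simp add: ac_simps)
  qed
  then have "wp (for_points key_body) (\<lambda>_. key_inv n) (n * (d * 40 + 54 + 6) + 9) s"
    by (rule wp_for_points[rotated])
      (use assms in \<open>auto simp: sum_inv_def key_inv_def input_def store_def\<close>)
  then show ?thesis by (simp add: add.commute)
qed

text \<open>The loop overwrites \<open>out\<close> while it keeps evaluating \<open>e\<close>. The
  premise \<open>frame\<close> says that \<open>e\<close> does not depend on that array, so its
  values can be taken in the state before the loop with only \<open>i\<close> changed.\<close>

lemma wp_out:
  assumes "nats s ''n'' 0 = n"
    and frame: "\<And>s'. (\<And>a. a \<noteq> ''out'' \<Longrightarrow> reals s' a = reals s a) \<Longrightarrow>
      rval e s' = rval e (s\<lparr>nats := nats s'\<rparr>)"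
  shows "wp (for_points (out_body e)) (\<lambda>_. out_inv s e n) (n * (rcost e + 15) + 9) s"
proof -
  have "wp (out_body e) (\<lambda>_. out_inv s e (Suc i)) (rcost e + 9) s'" if "out_inv s e i s'" for i s'
  proof -
    from that have n: "nats s' = store (nats s) ''i'' 0 i" by (simp add: out_inv_def)
    have "rval e s' = rval e (s\<lparr>nats := store (nats s) ''i'' 0 i\<rparr>)"
      using frame[of s'] that by (simp add: out_inv_def n)
    with that show ?thesis
      by (auto simp: out_body_def out_inv_def n store_def less_Suc_eq fun_eq_iff)
  qed
  then have "wp (for_points (out_body e)) (\<lambda>_. out_inv s e n) (n * (rcost e + 9 + 6) + 9) s"
    by (rule wp_for_points[rotated]) (use assms(1) in \<open>auto simp: out_inv_def store_def\<close>)
  then show ?thesis by (simp add: algebra_simps)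
qed

section \<open>Correctness and total cost of the program\<close>

definition answer :: "nat \<Rightarrow> real" where
  "answer i = (if 2 * eps < 1 then \<Sum>j<n. if x i = x j then 0 else y $ j else (\<Sum>j<n. y $ j) / 2)"

definition budget :: nat where
  "budget = (if 2 * eps < 1 then n * (d * 40 + 106) + 34 else n * 43 + 25)"

lemma out_inv_exact:
  assumes "x ` {..<n} \<subseteq> hypercube d" "2 * eps < 1" "key_inv n s" "out_inv s exact_answer n s'" "i < n"
  shows "reals s' ''out'' i = answer i"
proof -
  have "reals s' ''out'' i =
      (\<Sum>j<n. y $ j) - (\<Sum>j<n. if code d (x j) = code d (x i) then y $ j else 0)"
    using assms(3-5) by (simp add: out_inv_def key_inv_def exact_answer_def store_def)
  \<comment> \<open>Subtracting termwise cancels \<open>y $ j\<close> exactly where the codes agree,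
    that is, where the points agree.\<close>
  also have "\<dots> = (\<Sum>j<n. if x i = x j then 0 else y $ j)"
    unfolding sum_subtractf[symmetric]
  proof (rule sum.cong[OF refl])
    fix j assume "j \<in> {..<n}"
    then have "x i \<in> hypercube d" "x j \<in> hypercube d" using assms(1,5) by auto
    then have "code d (x j) = code d (x i) \<longleftrightarrow> x i = x j" by (metis code_eq_hypercube)
    then show "y $ j - (if code d (x j) = code d (x i) then y $ j else 0) =
        (if x i = x j then 0 else y $ j)"
      by simp
  qed
  finally show ?thesis using assms(2) by (simp add: answer_def)
qed

lemma out_inv_half:
  assumes "\<not> 2 * eps < 1" "sum_inv n s" "out_inv s half_answer n s'" "i < n"
  shows "reals s' ''out'' i = answer i"
  using assms by (simp add: out_inv_def sum_inv_def half_answer_def answer_def)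

lemma wp_query_prog:
  assumes "input s" "nats s ''p'' 0 = 0" "reals s ''W'' = (\<lambda>_. 0)" "reals s ''S'' 0 = 0"
    and cube: "x ` {..<n} \<subseteq> hypercube d"
  shows "wp query_prog (\<lambda>_ s'. \<forall>i<n. reals s' ''out'' i = answer i) budget s"
proof -
  let ?Q = "\<lambda>_ s'. \<forall>i<n. reals s' ''out'' i = answer i"
  have key: "wp (for_points key_body) (wp (for_points (out_body exact_answer)) ?Q)
      ((n * (d * 40 + 60) + 9) + (n * 22 + 9)) s'" if "2 * eps < 1" "sum_inv n s'" for s'
  proof (rule wp_conseq[OF wp_key[OF that(2)]])
    fix r assume r: "key_inv n r"
    have "wp (for_points (out_body exact_answer)) (\<lambda>_. out_inv r exact_answer n)
        (n * (rcost exact_answer + 15) + 9) r"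
      by (rule wp_out) (use r in \<open>auto simp: key_inv_def input_def exact_answer_def\<close>)
    then have "wp (for_points (out_body exact_answer)) (\<lambda>_. out_inv r exact_answer n)
        (n * 22 + 9) r"
      by (simp add: exact_answer_def)
    then show "wp (for_points (out_body exact_answer)) ?Q (n * 22 + 9) r"
      by (rule wp_mono) (auto intro: out_inv_exact[OF cube that(1) r])
  qed (rule wp_antimono_budget)
  have half: "wp (for_points (out_body half_answer)) ?Q (n * 19 + 9) s'"
    if "\<not> 2 * eps < 1" "sum_inv n s'" for s'
  proof -
    have "wp (for_points (out_body half_answer)) (\<lambda>_. out_inv s' half_answer n)
        (n * (rcost half_answer + 15) + 9) s'"
      by (rule wp_out) (use that in \<open>auto simp: sum_inv_def input_def half_answer_def\<close>)
    then have "wp (for_points (out_body half_answer)) (\<lambda>_. out_inv s' half_answer n)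
        (n * 19 + 9) s'"
      by (simp add: half_answer_def)
    then show ?thesis by (rule wp_mono) (auto intro: out_inv_half[OF that])
  qed
  let ?branch = "Cond (RLess (RMul (RConst 2) (rvar ''eps'')) (RConst 1))
      (Seq (for_points key_body) (for_points (out_body exact_answer)))
      (for_points (out_body half_answer))"
  define T where "T = budget - (n * 24 + 9)"
  \<comment> \<open>What is left after the summation loop; the 7 pays for testing
    \<open>2 * eps < 1\<close>.\<close>
  have T: "T = (if 2 * eps < 1 then (n * (d * 40 + 60) + 9) + (n * 22 + 9) + 7 else n * 19 + 9 + 7)"
    unfolding T_def budget_def by (simp add: algebra_simps)
  have "wp (for_points sum_body) (wp ?branch ?Q) (n * 24 + 9 + T) s"
  proof (rule wp_conseq[OF wp_sum[OF assms(1-4)]])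
    fix s' assume s': "sum_inv n s'"
    then have "bval (RLess (RMul (RConst 2) (rvar ''eps'')) (RConst 1)) s' \<longleftrightarrow> 2 * eps < 1"
      by (simp add: sum_inv_def input_def)
    with key[OF _ s'] half[OF _ s'] show "wp ?branch ?Q T s'"
      by (simp add: T add.commute del: bval.simps)
  qed (rule wp_antimono_budget, auto)
  moreover have "n * 24 + 9 + T = budget"
    unfolding T budget_def by (simp add: algebra_simps)
  ultimately show ?thesis unfolding query_prog_def by simp
qed

section \<open>The approximating matrix\<close>

text \<open>It does not involve \<open>y\<close>, so outside the locale it depends on
  \<open>n\<close>, \<open>eps\<close> and \<open>x\<close> only and can be chosen before the query
  vector.\<close>

definition approx :: "real mat" where
  "approx = (if 2 * eps < 1 then linf_dist_mat n x else mat n n (\<lambda>_. 1 / 2))"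

lemma approx_carrier: "approx \<in> carrier_mat n n"
  by (simp add: approx_def linf_dist_mat_def)

lemma approx_error:
  assumes "x ` {..<n} \<subseteq> hypercube d" "1 \<le> n" "1 \<le> d" "0 < eps"
  shows "mat_max_norm (linf_dist_mat n x - approx) \<le> eps"
proof (rule mat_max_norm_le)
  show "linf_dist_mat n x - approx \<in> carrier_mat n n"
    using approx_carrier by (simp add: minus_carrier_mat)
  fix i j assume ij: "i < n" "j < n"
  then have "vec_max_norm (x i - x j) = (if x i = x j then 0 else 1)"
    using assms by (intro vec_max_norm_hypercube) auto
  with ij \<open>0 < eps\<close> show "\<bar>(linf_dist_mat n x - approx) $$ (i, j)\<bar> \<le> eps"
    by (auto simp: approx_def linf_dist_mat_def)
qed (use assms in auto)

lemma approx_mult: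
  assumes "x ` {..<n} \<subseteq> hypercube d" "1 \<le> d" "y \<in> carrier_vec n" "i < n"
  shows "(approx *\<^sub>v y) $ i = answer i"
proof -
  have "vec_max_norm (x i - x j) * y $ j = (if x i = x j then 0 else y $ j)" if "j < n" for j
    using assms that by (subst vec_max_norm_hypercube[of _ d]) auto
  with assms(3,4) show ?thesis
    by (simp add: approx_def linf_dist_mat_def answer_def scalar_prod_def atLeast0LessThan
        sum_divide_distrib)
qed

lemma computes_within_budget:
  assumes "x ` {..<n} \<subseteq> hypercube d" "1 \<le> d" "y \<in> carrier_vec n" "real budget \<le> T"
  shows "computes_within query_prog (query_input n d eps x y) (approx *\<^sub>v y) T"
proof -
  \<comment> \<open>Row-major addresses stay inside the range where \<open>query_input\<close>
    stores the points instead of the default 0.\<close>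
  have "i * d + k < n * d" if "i < n" "k < d" for i k
  proof -
    have "i * d + k < Suc i * d" using that by simp
    also have "\<dots> \<le> n * d" using that by (intro mult_right_mono) auto
    finally show ?thesis .
  qed
  then have "wp query_prog (\<lambda>_ s'. \<forall>i<n. reals s' ''out'' i = answer i) budget
      (query_input n d eps x y)"
    using assms(1) by (intro wp_query_prog) (auto simp: input_def query_input_def)
  then obtain t s' where run: "runs query_prog (query_input n d eps x y) t s'" "t \<le> budget"
    and out: "\<forall>i<n. reals s' ''out'' i = answer i"
    unfolding wp_def by blast
  from run(2) assms(4) have "real t \<le> T" by linarith
  moreover have "\<forall>i<dim_vec (approx *\<^sub>v y). reals s' ''out'' i = (approx *\<^sub>v y) $ i"
    using out approx_mult[OF assms(1-3)] approx_carrier by auto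
  ultimately show ?thesis using run(1) unfolding computes_within_def by blast
qed

end

section \<open>Comparison of the cost with the claimed bound\<close>

text \<open>For \<open>d < 4\<close> the factor 4 suffices, as the power is at least 1. For larger
  \<open>d\<close> the exponent is at least 1, and the power is at least
  \<open>2 * d\<close>.\<close>

lemma dimension_le_powr:
  assumes "1 \<le> d" "0 < eps" "2 * eps < 1"
  shows "real d \<le> 4 * (2 * real d) powr (sqrt (real d) * ln (1 / eps))"
proof (cases "d < 4")
  case True
  have "1 \<le> (2 * real d) powr (sqrt (real d) * ln (1 / eps))"
    using assms by (intro ge_one_powr_ge_zero) auto
  with True show ?thesis by simp
next
  case False
  \<comment> \<open>From \<open>ln eps \<le> eps - 1\<close> and \<open>eps < 1 / 2\<close>.\<close>
  have "1 / 2 \<le> ln (1 / eps)"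
    using ln_le_minus_one[OF \<open>0 < eps\<close>] assms by (simp add: ln_div)
  moreover have "2 \<le> sqrt (real d)" using False by (simp add: real_le_rsqrt)
  ultimately have "2 * (1 / 2) \<le> sqrt (real d) * ln (1 / eps)" by (intro mult_mono) auto
  then have "(2 * real d) powr 1 \<le> (2 * real d) powr (sqrt (real d) * ln (1 / eps))"
    using assms by (intro powr_mono) auto
  with assms show ?thesis by simp
qed

lemma budget_le:
  assumes "1 \<le> n" "1 \<le> d" "0 < eps" "eps < 1"
  shows "real (query.budget n d eps) \<le>
    720 * (real n * (2 * real d) powr (sqrt (real d) * ln (1 / eps)))"
proof -
  let ?P = "(2 * real d) powr (sqrt (real d) * ln (1 / eps))"
  \<comment> \<open>The cost per point up to a constant: linear in \<open>d\<close> for the exact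
    answer, constant for the other one.\<close>
  define m where "m = (if 2 * eps < 1 then d else 1)"
  \<comment> \<open>Here 180 = 40 + 106 + 34, since both \<open>n\<close> and 1 are at most
    \<open>n * m\<close>; the final 720 is 4 times 180.\<close>
  have "query.budget n d eps \<le> 180 * (n * m)"
  proof -
    have "n \<le> n * m" "1 \<le> n * m" using assms by (auto simp: m_def)
    moreover have "query.budget n d eps \<le> 40 * (n * m) + 106 * n + 34"
      by (simp add: query.budget_def m_def algebra_simps)
    ultimately show ?thesis by linarith
  qed
  then have "real (query.budget n d eps) \<le> real (180 * (n * m))" by (rule of_nat_mono)
  also have "\<dots> = 180 * (real n * real m)" by simp
  also have "real m \<le> 4 * ?P"
  proof (cases "2 * eps < 1")
    case True
    then show ?thesis using dimension_le_powr[of d eps] assms by (simp add: m_def)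
  next
    case False
    have "1 \<le> ?P" using assms by (intro ge_one_powr_ge_zero) auto
    with False show ?thesis by (simp add: m_def)
  qed
  finally show ?thesis by (simp add: mult_left_mono)
qed

theorem theorem9:
  shows "\<exists>(P :: com) (C :: real). \<forall>(n :: nat) (d :: nat) (\<epsilon> :: real) (x :: nat \<Rightarrow> real vec).
    1 \<le> n \<longrightarrow> 1 \<le> d \<longrightarrow> 0 < \<epsilon> \<longrightarrow> \<epsilon> < 1 \<longrightarrow> x ` {..<n} \<subseteq> hypercube d \<longrightarrow>
    (\<exists>B \<in> carrier_mat n n.
       mat_max_norm (linf_dist_mat n x - B) \<le> \<epsilon> \<and>
       (\<forall>y \<in> carrier_vec n.
          computes_within P (query_input n d \<epsilon> x y) (B *\<^sub>v y)
            (C * (real n * (2 * real d) powr (sqrt (real d) * ln (1 / \<epsilon>))))))"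
\<comment> \<open>One program serves all inputs, as it decides between the two cases by testing
  \<open>eps\<close> itself.\<close>
proof (intro exI[of _ query_prog] exI[of _ 720] allI impI)
  fix n d :: nat and \<epsilon> :: real and x :: "nat \<Rightarrow> real vec"
  assume a: "1 \<le> n" "1 \<le> d" "0 < \<epsilon>" "\<epsilon> < 1" "x ` {..<n} \<subseteq> hypercube d"
  let ?B = "query.approx n \<epsilon> x"
  show "\<exists>B \<in> carrier_mat n n.
       mat_max_norm (linf_dist_mat n x - B) \<le> \<epsilon> \<and>
       (\<forall>y \<in> carrier_vec n.
          computes_within query_prog (query_input n d \<epsilon> x y) (B *\<^sub>v y)
            (720 * (real n * (2 * real d) powr (sqrt (real d) * ln (1 / \<epsilon>)))))"
    using query.approx_carrier query.approx_error[OF a(5,1-3)]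
      query.computes_within_budget[OF a(5,2) _ budget_le[OF a(1-4)]] by blast
qed

end
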